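(* For any $N\in\mathbb{N}$, the sets $\mathcal{W}^*_{\le N}$ and ${}^*\mathcal{W}_{\le N}$ are bases of words for $\mathcal{W}_N$ with minimal computational cost when using, respectively, the backward and the forward approach: for every integer $K\ge2$ and every basis of words $B\subset\mathcal{W}_{\le N}$ for $\mathcal{W}_N$, $$C_{\mathrm b}(\mathcal{W}^*_{\le N},K)\le C_{\mathrm b}(B,K)\qquad\text{and}\qquad C_{\mathrm f}({}^*\mathcal{W}_{\le N},K)\le C_{\mathrm f}(B,K).$$
   Context: $\mathbb{N}=\{0,1,2,\dots\}$. Fix an integer $d\ge 1$ and the alphabet $\mathcal{A}=\{0,1,\dots,d\}$. $\mathcal{W}_N$ is the set of words of length $N$ over $\mathcal{A}$ (with $\mathcal{W}_0=\{\epsilon\}$, $\epsilon$ the empty word), $\mathcal{W}_{\le N}=\bigsqcup_{k=0}^N\mathcal{W}_k$, $\mathcal{W}_{<\infty}=\bigsqcup_{k\ge0}\mathcal{W}_k$; $\|w\|$ is the length of a word $w$; $0_k$ is the word made of $k$ letters $0$ ($0_0=\epsilon$). For a set $C$ of words, $\mathrm{Span}(C)$ is the real vector space of formal finite linear combinations of elements of $C$. Concatenation of words is extended bilinearly. The shuffle product $\sqcup\!\sqcup$ is defined inductively by $w\sqcup\!\sqcup\epsilon=\epsilon\sqcup\!\sqcup w=w$ and $(wi)\sqcup\!\sqcup(vj)=(w\sqcup\!\sqcup(vj))i+((wi)\sqcup\!\sqcup v)j$ for words $w,v$ and letters $i,j$, and extended bilinearly. A subset $B\subset\mathcal{W}_{\le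 N}$ is a basis of words for $\mathcal{W}_N$ if the family $(w\sqcup\!\sqcup 0_{N-\|w\|})_{w\in B}$ is a basis of $\mathrm{Span}(\mathcal{W}_N)$. $\mathcal{W}^*_{\le N}$ (prefixes) is the set of words of $\mathcal{W}_{\le N}$ that are empty or whose last letter is not $0$; ${}^*\mathcal{W}_{\le N}$ (suffixes) is the set of words of $\mathcal{W}_{\le N}$ that are empty or whose first letter is not $0$. For a finite set $B$ of words, $L(B)=\sum_{w\in B}\|w\|$ is its length, and $$\Phi_{\mathrm f}(B)=\{w\in\mathcal{W}_{<\infty}:\exists v\in\mathcal{W}_{<\infty},\ wv\in B\},\qquad \Phi_{\mathrm b}(B)=\{w\in\mathcal{W}_{<\infty}:\exists v\in\mathcal{W}_{<\infty},\ vw\in B\}.$$ The computational costs (number of elementary operations needed to compute, by recursive use of Chen's relation, the terminal time-augmented signature components indexed by $B$ of a concatenation of $K\ge2$ affine paths, with unit cost for each signature component of an affine path) are $$C_{\mathrm f}(B,K)=\mathrm{Card}(\Phi_{\mathrm f}(B))+2(K-2)L(\Phi_{\mathrm f}(B))+2L(B)\quad\text{(forward approach)},$$ $$C_{\mathrm b}(B,K)=\mathrm{Card}(\Phi_{\mathrm b}(B))+2(K-2)L(\Phi_{\mathrm b}(B))+2L(B)\quad\text{(backward approach)}.$$ *)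

theory Defs
  imports "HOL-Analysis.Analysis" "HOL-Analysis.Finite_Function_Topology"
begin

type_synonym word = "nat list"

definition words :: "nat \<Rightarrow> nat \<Rightarrow> word set" where
  "words d N = {w \<in> lists {0..d}. length w = N}"

definition words_upto :: "nat \<Rightarrow> nat \<Rightarrow> word set" where
  "words_upto d N = (\<Union>k\<in>{0..N}. words d k)"

definition all_words :: "nat \<Rightarrow> word set" where
  "all_words d = (\<Union>k. words d k)"

definition prefixes_upto :: "nat \<Rightarrow> nat \<Rightarrow> word set" where
  "prefixes_upto d N = {w \<in> words_upto d N. w = [] \<or> last w \<noteq> 0}"

definition suffixes_upto :: "nat \<Rightarrow> nat \<Rightarrow> word set" where
  "suffixes_upto d N = {w \<in> words_upto d N. w = [] \<or> hd w \<noteq> 0}"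

text \<open>
  Formal finite real linear combinations of words are elements of
  \<^typ>\<open>word \<Rightarrow>\<^sub>0 real\<close>, which is already an instance of \<^class>\<open>real_vector\<close>.
\<close>

definition of_word :: "word \<Rightarrow> word \<Rightarrow>\<^sub>0 real" where
  "of_word w = Poly_Mapping.single w 1"

definition Span :: "word set \<Rightarrow> (word \<Rightarrow>\<^sub>0 real) set" where
  "Span C = span (of_word ` C)"

text \<open>Bilinear extension of word concatenation.\<close>

definition conc :: "(word \<Rightarrow>\<^sub>0 real) \<Rightarrow> (word \<Rightarrow>\<^sub>0 real) \<Rightarrow> word \<Rightarrow>\<^sub>0 real" where
  "conc p q = (\<Sum>u\<in>Poly_Mapping.keys p. \<Sum>v\<in>Poly_Mapping.keys q.
     (Poly_Mapping.lookup p u * Poly_Mapping.lookup q v) *\<^sub>R of_word (u @ v))"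

text \<open>
  The shuffle product of two words recurses on last letters, so it is written with
  \<^const>\<open>butlast\<close> and \<^const>\<open>last\<close>; the lemmas after the definition restate it as the usual
  recursion.
\<close>

function shuffle :: "word \<Rightarrow> word \<Rightarrow> word \<Rightarrow>\<^sub>0 real" where
  "shuffle w v =
     (if v = [] then of_word w
      else if w = [] then of_word v
      else conc (shuffle (butlast w) v) (of_word [last w])
         + conc (shuffle w (butlast v)) (of_word [last v]))"
  by auto
termination
  by (relation "Wellfounded.measure (\<lambda>(w, v). length w + length v)") auto

declare shuffle.simps [simp del]

lemma conc_of_word: "conc (of_word u) (of_word v) = of_word (u @ v)"
  by (simp add: conc_def of_word_def)

lemma shuffle_Nil: "shuffle w [] = of_word w" "shuffle [] w = of_word w"
  by (simp_all add: shuffle.simps)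

lemma shuffle_snoc:
  "shuffle (w @ [i]) (v @ [j]) =
     conc (shuffle w (v @ [j])) (of_word [i]) + conc (shuffle (w @ [i]) v) (of_word [j])"
  by (subst shuffle.simps) simp

text \<open>
  A family indexed by \<open>B\<close> is linearly independent iff it is injective on \<open>B\<close> and has
  linearly independent range.
\<close>

definition basis_of_words :: "nat \<Rightarrow> nat \<Rightarrow> word set \<Rightarrow> bool" where
  "basis_of_words d N B \<longleftrightarrow>
     B \<subseteq> words_upto d N \<and>
     (let f = (\<lambda>w. shuffle w (replicate (N - length w) 0)) in
        inj_on f B \<and> independent (f ` B) \<and> span (f ` B) = Span (words d N))"

definition word_length_sum :: "word set \<Rightarrow> nat" where
  "word_length_sum B = (\<Sum>w\<in>B. length w)"

definition forward_closure :: "nat \<Rightarrow> word set \<Rightarrow> word set" where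
  "forward_closure d B = {w \<in> all_words d. \<exists>v\<in>all_words d. w @ v \<in> B}"

definition backward_closure :: "nat \<Rightarrow> word set \<Rightarrow> word set" where
  "backward_closure d B = {w \<in> all_words d. \<exists>v\<in>all_words d. v @ w \<in> B}"

text \<open>The costs are only meaningful for \<open>K \<ge> 2\<close>, where the truncated subtraction is exact.\<close>

definition forward_cost :: "nat \<Rightarrow> word set \<Rightarrow> nat \<Rightarrow> nat" where
  "forward_cost d B K =
     card (forward_closure d B) + 2 * (K - 2) * word_length_sum (forward_closure d B)
       + 2 * word_length_sum B"

definition backward_cost :: "nat \<Rightarrow> word set \<Rightarrow> nat \<Rightarrow> nat" where
  "backward_cost d B K =
     card (backward_closure d B) + 2 * (K - 2) * word_length_sum (backward_closure d B)
       + 2 * word_length_sum B"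

end

theory Submission
  imports Defs
begin

text \<open>
  Both families are triangular with respect to \<open>words d N\<close>: if \<open>w\<close> does not end in \<open>0\<close>, then
  among the words occurring in the shuffle of \<open>w\<close> with \<open>0\<^sub>m\<close> only \<open>w 0\<^sub>m\<close> ends in \<open>m\<close> zeros, and
  similarly with leading zeros.

  For minimality, the prefixes are closed under taking suffixes, so \<open>\<Phi>\<^sub>b\<close> fixes them, and every
  term of the cost is bounded below once \<open>L(B) \<ge> L(\<W>\<^sup>*\<^bsub>\<le>N\<^esub>)\<close> is known for all bases \<open>B\<close>. Up to a
  nonzero scalar, shuffling \<open>w\<close> with \<open>0\<^sub>m\<close> amounts to shuffling \<open>m\<close> times with the letter \<open>0\<close>; hence
  the elements of \<open>B\<close> of length at most \<open>k\<close> give vectors in the span of \<open>(d + 1)\<^sup>k\<close> vectors, so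
  there are at most \<open>(d + 1)\<^sup>k\<close> of them, with equality for the prefixes.
\<close>

section \<open>Coordinates of formal combinations, and appending a letter\<close>

lemma lookup_scaleR [simp]:
  "Poly_Mapping.lookup (r *\<^sub>R p) x = r *\<^sub>R Poly_Mapping.lookup p x"
  for p :: "'a \<Rightarrow>\<^sub>0 'b::real_vector"
  unfolding scaleR_poly_mapping_def
  by (subst Abs_poly_mapping_inverse)
    (auto intro: finite_subset[OF _ finite_keys[of p]] simp: in_keys_iff)

lemma lookup_of_word: "Poly_Mapping.lookup (of_word w) u = (if u = w then 1 else 0)"
  by (simp add: of_word_def lookup_single when_def)

lemma inj_of_word: "inj of_word"
  by (rule injI) (metis lookup_of_word one_neq_zero)

lemma poly_mapping_sum_of_word:
  "p = (\<Sum>v\<in>Poly_Mapping.keys p. Poly_Mapping.lookup p v *\<^sub>R of_word v)"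
  by (rule poly_mapping_eqI)
    (simp add: lookup_sum lookup_of_word in_keys_iff if_distrib sum.delta' cong: if_cong)

lemma independent_of_word: "independent (of_word ` W)"
  unfolding independent_explicit_finite_subsets
proof (intro allI impI ballI)
  fix S u p
  assume S: "S \<subseteq> of_word ` W" "finite S" "(\<Sum>v\<in>S. u v *\<^sub>R v) = 0" and p: "p \<in> S"
  obtain U where U: "S = of_word ` U" "finite U"
    using S(1,2) by (metis finite_subset_image)
  then obtain w where w: "w \<in> U" "p = of_word w" using p by auto
  have "0 = Poly_Mapping.lookup (\<Sum>v\<in>S. u v *\<^sub>R v) w" using S(3) by simp
  also have "\<dots> = (\<Sum>v\<in>U. if w = v then u (of_word v) else 0)"
    unfolding U(1) by (subst sum.reindex)
      (auto simp: lookup_sum lookup_of_word inj_on_def dest: injD[OF inj_of_word] intro!: sum.cong)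
  also have "\<dots> = u p" using U(2) w by simp
  finally show "u p = 0" by simp
qed

lemma lookup_conc_letter_Nil: "Poly_Mapping.lookup (conc p (of_word [i])) [] = 0"
  by (simp add: conc_def lookup_sum lookup_of_word of_word_def[of "[i]"])

text \<open>Appending a fixed letter is injective on words, so only the term for \<open>u\<close> of
  the sum defining \<open>conc\<close> can reach \<open>u @ [j]\<close>.\<close>

lemma lookup_conc_letter_snoc:
  "Poly_Mapping.lookup (conc p (of_word [i])) (u @ [j]) =
     (if i = j then Poly_Mapping.lookup p u else 0)"
proof -
  have "Poly_Mapping.keys (of_word [i]) = {[i]}" by (simp add: of_word_def)
  then have "Poly_Mapping.lookup (conc p (of_word [i])) (u @ [j]) =
      (\<Sum>v\<in>Poly_Mapping.keys p. Poly_Mapping.lookup p v * (if u @ [j] = v @ [i] then 1 else 0))"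
    by (simp add: conc_def lookup_sum lookup_of_word)
  also have "\<dots> =
      (\<Sum>v\<in>Poly_Mapping.keys p. if v = u then (if i = j then Poly_Mapping.lookup p u else 0) else 0)"
    by (rule sum.cong) auto
  finally show ?thesis by (simp add: in_keys_iff)
qed

lemma lookup_conc_letter:
  "Poly_Mapping.lookup (conc p (of_word [i])) u =
     (if u \<noteq> [] \<and> last u = i then Poly_Mapping.lookup p (butlast u) else 0)"
  by (cases u rule: rev_cases) (auto simp: lookup_conc_letter_Nil lookup_conc_letter_snoc)

lemma linear_conc_letter: "linear (\<lambda>p. conc p (of_word [i]))"
  by (rule linearI) (auto intro!: poly_mapping_eqI simp: lookup_conc_letter lookup_add)

lemmas conc_letter_linear_simps =
  linear_add[OF linear_conc_letter] linear_scale[OF linear_conc_letter] linear_sum[OF linear_conc_letter]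

abbreviation zeros :: "nat \<Rightarrow> word" where
  "zeros m \<equiv> replicate m 0"

lemma shuffle_zeros_snoc:
  "shuffle (w @ [i]) (zeros (Suc m)) =
     conc (shuffle w (zeros (Suc m))) (of_word [i]) + conc (shuffle (w @ [i]) (zeros m)) (of_word [0])"
  using shuffle_snoc[of w i "zeros m" 0] by (simp add: replicate_append_same)

subsection \<open>Words occurring in a shuffle with zeros\<close>

text \<open>The recursion on last letters never leaves the shuffles with a block of zeros, so
  induction on \<open>length w + m\<close> applies. The cases follow \<open>shuffle_Nil\<close> and
  \<open>shuffle_zeros_snoc\<close>.\<close>

lemma shuffle_zeros_induct [case_names zero Nil snoc]:
  assumes "\<And>w. P w 0" and "\<And>m. P [] (Suc m)"
    and "\<And>w i m. P w (Suc m) \<Longrightarrow> P (w @ [i]) m \<Longrightarrow> P (w @ [i]) (Suc m)"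
  shows "P w m"
proof (induction "length w + m" arbitrary: w m rule: less_induct)
  case less
  show ?case
  proof (cases m)
    case (Suc k)
    show ?thesis
    proof (cases w rule: rev_cases)
      case (snoc v i)
      have "P v (Suc k)" "P (v @ [i]) k"
        using less snoc Suc by simp_all
      then show ?thesis using assms(3) snoc Suc by simp
    qed (use assms(2) Suc in simp)
  qed (use assms(1) in simp)
qed

lemma lookup_shuffle_zeros_snoc:
  "Poly_Mapping.lookup (shuffle (w @ [i]) (zeros (Suc m))) (u @ [j]) =
     (if i = j then Poly_Mapping.lookup (shuffle w (zeros (Suc m))) u else 0)
     + (if j = 0 then Poly_Mapping.lookup (shuffle (w @ [i]) (zeros m)) u else 0)"
  unfolding shuffle_zeros_snoc lookup_add lookup_conc_letter_snoc by simp

lemma lookup_shuffle_zeros_snoc_Nil: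
  "Poly_Mapping.lookup (shuffle (w @ [i]) (zeros (Suc m))) [] = 0"
  unfolding shuffle_zeros_snoc by (simp add: lookup_add lookup_conc_letter_Nil)

text \<open>Excludes cancellation between the two summands of the recursion, which can both
  contribute when \<open>i = 0\<close>.\<close>

lemma shuffle_zeros_nonneg: "0 \<le> Poly_Mapping.lookup (shuffle w (zeros m)) u"
proof (induction w m arbitrary: u rule: shuffle_zeros_induct)
  case (snoc w i m)
  then show ?case
    by (cases u rule: rev_cases)
      (simp_all only: lookup_shuffle_zeros_snoc lookup_shuffle_zeros_snoc_Nil, auto)
qed (simp_all add: shuffle_Nil lookup_of_word)

text \<open>Backbone of the inductions on supports: the last letter comes either from the word or
  from the block of zeros.\<close>

lemma shuffle_zeros_keys_snocE:
  assumes "u \<in> Poly_Mapping.keys (shuffle (w @ [i]) (zeros (Suc m)))"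
  obtains (letter) v where "u = v @ [i]" "v \<in> Poly_Mapping.keys (shuffle w (zeros (Suc m)))"
  | (zero) v where "u = v @ [0]" "v \<in> Poly_Mapping.keys (shuffle (w @ [i]) (zeros m))"
proof (cases u rule: rev_cases)
  case Nil
  then show ?thesis using assms by (simp only: in_keys_iff lookup_shuffle_zeros_snoc_Nil)
next
  case (snoc v j)
  then have "(i = j \<and> Poly_Mapping.lookup (shuffle w (zeros (Suc m))) v \<noteq> 0) \<or>
      (j = 0 \<and> Poly_Mapping.lookup (shuffle (w @ [i]) (zeros m)) v \<noteq> 0)"
    using assms unfolding in_keys_iff snoc lookup_shuffle_zeros_snoc
    by (auto simp del: replicate_Suc split: if_splits)
  then show ?thesis
    using snoc that unfolding in_keys_iff by blast
qed

lemma keys_shuffle_zeros_letters: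
  assumes "u \<in> Poly_Mapping.keys (shuffle w (zeros m))"
  shows "length u = length w + m" "set u \<subseteq> insert 0 (set w)"
proof -
  have "length u = length w + m \<and> set u \<subseteq> insert 0 (set w)"
    using assms
  proof (induction w m arbitrary: u rule: shuffle_zeros_induct)
    case (snoc w i m)
    from snoc.prems show ?case
    proof (cases rule: shuffle_zeros_keys_snocE)
      case (letter v)
      then show ?thesis using snoc.IH(1)[of v] by auto
    next
      case (zero v)
      then show ?thesis using snoc.IH(2)[of v] by auto
    qed
  qed (auto simp: shuffle_Nil in_keys_iff lookup_of_word split: if_splits)
  then show "length u = length w + m" "set u \<subseteq> insert 0 (set w)" by simp_all
qed

lemma keys_shuffle_zeros_words:
  assumes "u \<in> Poly_Mapping.keys (shuffle w (zeros m))" "w \<in> words d k"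
  shows "u \<in> words d (k + m)"
  using keys_shuffle_zeros_letters[OF assms(1)] assms(2) by (auto simp: words_def)

text \<open>The final zero can be taken from the block, so the second summand of the recursion is
  positive by induction, and the first one is nonnegative.\<close>

lemma lookup_shuffle_zeros_append: "0 < Poly_Mapping.lookup (shuffle w (zeros m)) (w @ zeros m)"
proof (induction w m rule: shuffle_zeros_induct)
  case (snoc w i m)
  have "(w @ [i]) @ zeros (Suc m) = ((w @ [i]) @ zeros m) @ [0]"
    by (simp add: replicate_append_same)
  then show ?case
    using snoc(2) shuffle_zeros_nonneg[of w "Suc m" "(w @ [i]) @ zeros m"]
    by (simp only: lookup_shuffle_zeros_snoc) auto
qed (simp_all add: shuffle_Nil lookup_of_word)

text \<open>Now the final letter is taken from the word, so the first summand is the positive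
  one.\<close>

lemma lookup_shuffle_zeros_prepend: "0 < Poly_Mapping.lookup (shuffle w (zeros m)) (zeros m @ w)"
proof (induction w m rule: shuffle_zeros_induct)
  case (snoc w i m)
  have "zeros (Suc m) @ w @ [i] = (zeros (Suc m) @ w) @ [i]" by simp
  then show ?case
    using snoc(1) shuffle_zeros_nonneg[of "w @ [i]" m "zeros (Suc m) @ w"]
    by (simp only: lookup_shuffle_zeros_snoc) auto
qed (simp_all add: shuffle_Nil lookup_of_word)

text \<open>This is the grading behind the triangular system for the suffixes; for the prefixes it
  is applied to reversed words, where it counts trailing zeros.\<close>

definition leading_zeros :: "word \<Rightarrow> nat" where
  "leading_zeros u = length (takeWhile (\<lambda>i. i = 0) u)"

lemma leading_zeros_zeros_append:
  "w = [] \<or> hd w \<noteq> 0 \<Longrightarrow> leading_zeros (zeros m @ w) = m"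
  by (cases w) (simp_all add: leading_zeros_def takeWhile_append)

lemma leading_zeros_snoc_le: "leading_zeros (u @ [j]) \<le> Suc (leading_zeros u)"
  by (auto simp: leading_zeros_def takeWhile_append takeWhile_eq_all_conv[THEN iffD2])

lemma leading_zeros_snoc:
  assumes "leading_zeros u < length u"
  shows "leading_zeros (u @ [j]) = leading_zeros u"
proof -
  have "takeWhile (\<lambda>i. i = 0) u \<noteq> u"
    using assms unfolding leading_zeros_def by (metis less_irrefl)
  then have "\<not> (\<forall>x\<in>set u. x = 0)"
    unfolding takeWhile_eq_all_conv .
  then show ?thesis by (auto simp: leading_zeros_def takeWhile_append)
qed

text \<open>If the last letter comes from \<open>w\<close>, it is nonzero and there are no trailing
  zeros at all. If it comes from the block, removing it lowers both the count and the bound by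
  one.\<close>

lemma keys_shuffle_zeros_trailing:
  assumes "u \<in> Poly_Mapping.keys (shuffle w (zeros m))" "w = [] \<or> last w \<noteq> 0"
  shows "u = w @ zeros m \<or> leading_zeros (rev u) < m"
  using assms
proof (induction w m arbitrary: u rule: shuffle_zeros_induct)
  case (snoc w i m)
  from snoc.prems(1) show ?case
  proof (cases rule: shuffle_zeros_keys_snocE)
    case (letter v)
    then show ?thesis using snoc.prems(2) by (simp add: leading_zeros_def)
  next
    case (zero v)
    then show ?thesis using snoc.IH(2)[of v] snoc.prems(2)
      by (auto simp: leading_zeros_def replicate_append_same)
  qed
qed (auto simp: shuffle_Nil in_keys_iff lookup_of_word split: if_splits)

text \<open>The recursion removes letters at the end while zeros are counted at the front, so each
  case has to control how appending a letter changes the count.\<close>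

lemma keys_shuffle_zeros_leading:
  assumes "u \<in> Poly_Mapping.keys (shuffle w (zeros m))" "w = [] \<or> hd w \<noteq> 0"
  shows "u = zeros m @ w \<or> leading_zeros u < m"
  using assms
proof (induction w m arbitrary: u rule: shuffle_zeros_induct)
  case (snoc w i m)
  from snoc.prems(1) show ?case
  proof (cases rule: shuffle_zeros_keys_snocE)
    case (letter v)
    have "w = [] \<or> hd w \<noteq> 0" using snoc.prems(2) by (cases w) auto
    with letter consider "v = zeros (Suc m) @ w" | "leading_zeros v < Suc m"
      using snoc.IH(1) by blast
    then show ?thesis
    proof cases
      case 2
      \<comment> \<open>A count of at most \<open>m\<close> in a word of length at least
        \<open>m + 1\<close> stops at a nonzero letter, so appending \<open>i\<close> leaves it
        unchanged.\<close>
      have "length v \<ge> Suc m"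
        using keys_shuffle_zeros_letters(1)[OF letter(2)] by simp
      then show ?thesis using 2 leading_zeros_snoc[of v i] letter(1) by simp
    qed (use letter(1) in simp)
  next
    case (zero v)
    then consider "v = zeros m @ w @ [i]" | "leading_zeros v < m"
      using snoc.IH(2)[of v] snoc.prems(2) by auto
    then show ?thesis
    proof cases
      case 1
      \<comment> \<open>The nonzero head of \<open>w @ [i]\<close> ends the run of zeros, so the
        appended zero is not counted and the total stays below \<open>Suc m\<close>.\<close>
      then have "leading_zeros v = m"
        using leading_zeros_zeros_append[of "w @ [i]" m] snoc.prems(2) by simp
      moreover have "leading_zeros v < length v" using calculation 1 by simp
      ultimately show ?thesis using leading_zeros_snoc[of v 0] zero(1) by simp
    next
      case 2
      then show ?thesis using leading_zeros_snoc_le[of v 0] zero(1) by simp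
    qed
  qed
qed (auto simp: shuffle_Nil in_keys_iff lookup_of_word split: if_splits)

subsection \<open>Bases of words\<close>

lemma finite_words: "finite (words d N)"
  and card_words: "card (words d N) = Suc d ^ N"
proof -
  have "words d N = {w. set w \<subseteq> {0..d} \<and> length w = N}" by (auto simp: words_def)
  then show "finite (words d N)" "card (words d N) = Suc d ^ N"
    by (simp_all add: finite_lists_length_eq card_lists_length_eq)
qed

lemma words_upto_iff: "w \<in> words_upto d N \<longleftrightarrow> set w \<subseteq> {0..d} \<and> length w \<le> N"
  by (auto simp: words_upto_def words_def)

lemma finite_words_upto: "finite (words_upto d N)"
  by (simp add: words_upto_def finite_words)

abbreviation shuffle_fill :: "nat \<Rightarrow> word \<Rightarrow> word \<Rightarrow>\<^sub>0 real" where
  "shuffle_fill N \<equiv> \<lambda>w. shuffle w (zeros (N - length w))"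

lemma shuffle_fill_in_Span:
  assumes "w \<in> words_upto d N"
  shows "shuffle_fill N w \<in> Span (words d N)"
proof -
  have "w \<in> words d (length w)" "length w \<le> N"
    using assms by (auto simp: words_upto_iff words_def)
  then have "Poly_Mapping.keys (shuffle_fill N w) \<subseteq> words d N"
    using keys_shuffle_zeros_words[of _ w "N - length w" d "length w"] by auto
  then show ?thesis
    unfolding Span_def
    by (subst poly_mapping_sum_of_word[of "shuffle_fill N w"]) (auto intro!: span_sum span_scale intro: span_base)
qed

lemma independent_of_card_le:
  fixes f :: "'a \<Rightarrow> 'b::real_vector"
  assumes "finite B" "independent S" "S \<subseteq> span (f ` B)" "card B \<le> card S"
  shows "inj_on f B" "independent (f ` B)"
proof -
  obtain C where C: "C \<subseteq> f ` B" "independent C" "f ` B \<subseteq> span C"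
    using maximal_independent_subset by blast
  have "finite C" using C(1) assms(1) finite_subset by blast
  moreover have "S \<subseteq> span C" using assms(3) span_minimal[OF C(3) subspace_span] by blast
  ultimately have "card S \<le> card C" using independent_span_bound[OF _ assms(2)] by blast
  then have le: "card B \<le> card C" using assms(4) by simp
  have "card C \<le> card (f ` B)" using C(1) assms(1) by (simp add: card_mono)
  with le have "card (f ` B) = card B" "card C = card (f ` B)"
    using card_image_le[OF assms(1), of f] by simp_all
  then show "inj_on f B" "independent (f ` B)"
    using assms(1) C(1,2) eq_card_imp_inj_on card_subset_eq[of "f ` B" C] by auto
qed

text \<open>Each \<open>u\<close> is the leading term, with respect to \<open>t\<close>, of some
  member of the family. Solving for \<open>u\<close> by induction on \<open>t u\<close> gives
  spanning; the bound on \<open>card B\<close> then forces independence.\<close>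

lemma basis_of_words_triangular:
  fixes t :: "word \<Rightarrow> nat"
  assumes B: "B \<subseteq> words_upto d N" and card: "card B \<le> Suc d ^ N"
    and tri: "\<And>u. u \<in> words d N \<Longrightarrow> \<exists>w\<in>B. Poly_Mapping.lookup (shuffle_fill N w) u \<noteq> 0 \<and>
      (\<forall>v\<in>Poly_Mapping.keys (shuffle_fill N w). v = u \<or> t v < t u)"
  shows "basis_of_words d N B"
proof -
  let ?f = "shuffle_fill N"
  have finB: "finite B" using B finite_words_upto finite_subset by blast
  have of_word_span: "of_word u \<in> span (?f ` B)" if "u \<in> words d N" for u
    using that
  proof (induction "t u" arbitrary: u rule: less_induct)
    case less
    obtain w where w: "w \<in> B" "Poly_Mapping.lookup (?f w) u \<noteq> 0"
      and keys: "\<And>v. v \<in> Poly_Mapping.keys (?f w) \<Longrightarrow> v = u \<or> t v < t u"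
      using tri[OF less.prems] by blast
    let ?c = "Poly_Mapping.lookup (?f w)"
    have "w \<in> words d (length w)" "length w \<le> N"
      using subsetD[OF B w(1)] by (auto simp: words_upto_iff words_def)
    then have keys_words: "v \<in> words d N" if "v \<in> Poly_Mapping.keys (?f w)" for v
      using keys_shuffle_zeros_words[OF that, of d "length w"] by simp
    let ?rest = "\<Sum>v\<in>Poly_Mapping.keys (?f w) - {u}. ?c v *\<^sub>R of_word v"
    have "?f w = ?c u *\<^sub>R of_word u + ?rest"
      using poly_mapping_sum_of_word[of "?f w"] w(2)
      by (simp add: sum.remove[of _ u] in_keys_iff)
    then have "?f w - ?rest = ?c u *\<^sub>R of_word u" by (simp add: diff_eq_eq)
    then have "of_word u = (1 / ?c u) *\<^sub>R (?f w - ?rest)" using w(2) by simp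
    \<comment> \<open>All words of the remainder have smaller \<open>t\<close>, so the induction
      hypothesis covers them.\<close>
    moreover have "?rest \<in> span (?f ` B)"
      by (intro span_sum span_scale less.hyps) (use keys keys_words in auto)
    moreover have "?f w \<in> span (?f ` B)" using w(1) by (auto intro: span_base)
    ultimately show ?case by (auto intro: span_scale span_diff)
  qed
  have "inj_on ?f B" "independent (?f ` B)"
    using independent_of_card_le[of B "of_word ` words d N" ?f] finB of_word_span card
    by (auto simp: independent_of_word card_image[OF inj_on_subset[OF inj_of_word]] card_words)
  moreover have "span (?f ` B) \<subseteq> Span (words d N)"
    using B shuffle_fill_in_Span unfolding Span_def
    by (intro span_minimal) auto
  moreover have "Span (words d N) \<subseteq> span (?f ` B)"
    using of_word_span unfolding Span_def by (intro span_minimal) auto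
  ultimately show ?thesis
    using B by (auto simp: basis_of_words_def Let_def)
qed

section \<open>Unique decomposition of words by their trailing zeros\<close>

lemma bij_betw_prefixes_words:
  "bij_betw (\<lambda>w. w @ zeros (N - length w)) (prefixes_upto d N) (words d N)"
proof -
  let ?fill = "\<lambda>w. w @ zeros (N - length w)"
  \<comment> \<open>The inverse map: strip all trailing zeros.\<close>
  let ?trim = "\<lambda>u. rev (dropWhile (\<lambda>i. i = 0) (rev u))"
  have dw: "dropWhile (\<lambda>i. i = 0) (zeros k @ x) = dropWhile (\<lambda>i. i = 0) x" for k x
    by (induction k) auto
  have trim_fill: "\<forall>w\<in>prefixes_upto d N. ?trim (?fill w) = w"
  proof
    fix w assume "w \<in> prefixes_upto d N"
    then have "w = [] \<or> last w \<noteq> 0" by (simp add: prefixes_upto_def)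
    then show "?trim (?fill w) = w"
      by (cases w rule: rev_cases) (simp_all add: dw)
  qed
  have split: "?trim u @ zeros (leading_zeros (rev u)) = u" for u
  proof -
    have "takeWhile (\<lambda>i. i = 0) (rev u) = zeros (leading_zeros (rev u))"
      unfolding leading_zeros_def
      by (rule replicate_length_same[symmetric]) (auto dest: set_takeWhileD)
    then have "rev u = zeros (leading_zeros (rev u)) @ dropWhile (\<lambda>i. i = 0) (rev u)"
      by (metis takeWhile_dropWhile_id)
    then show ?thesis by (metis rev_append rev_replicate rev_rev_ident)
  qed
  have fill_trim: "\<forall>u\<in>words d N. ?fill (?trim u) = u"
  proof
    fix u assume u: "u \<in> words d N"
    have "length (?trim u) + leading_zeros (rev u) = N"
      using arg_cong[OF split[of u], of length] u by (simp add: words_def)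
    then have "N - length (?trim u) = leading_zeros (rev u)" by simp
    then show "?fill (?trim u) = u" using split[of u] by (simp only:)
  qed
  have fill_words: "?fill ` prefixes_upto d N \<subseteq> words d N"
    by (auto simp: prefixes_upto_def words_upto_iff words_def)
  have trim_prefixes: "?trim ` words d N \<subseteq> prefixes_upto d N"
  proof (rule image_subsetI)
    fix u assume u: "u \<in> words d N"
    have "length (dropWhile (\<lambda>i. i = 0) (rev u)) \<le> N"
      using u length_dropWhile_le[of _ "rev u"] by (simp add: words_def)
    moreover have "?trim u = [] \<or> last (?trim u) \<noteq> 0"
      by (metis (full_types) hd_dropWhile last_rev rev_is_Nil_conv)
    moreover have "set (?trim u) \<subseteq> {0..d}"
      using u by (auto simp: words_def dest: set_dropWhileD)
    ultimately show "?trim u \<in> prefixes_upto d N"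
      unfolding prefixes_upto_def mem_Collect_eq words_upto_iff length_rev by blast
  qed
  show ?thesis
    by (rule bij_betw_byWitness[OF trim_fill fill_trim fill_words trim_prefixes])
qed

lemma words_trailing_zerosE:
  assumes "u \<in> words d N"
  obtains w where "w \<in> prefixes_upto d N" "u = w @ zeros (N - length w)"
  using assms bij_betw_imp_surj_on[OF bij_betw_prefixes_words[of N d]] by blast

lemma card_prefixes_upto: "card (prefixes_upto d N) = Suc d ^ N"
  using bij_betw_same_card[OF bij_betw_prefixes_words] card_words by simp

lemma suffixes_eq_rev_prefixes: "suffixes_upto d N = rev ` prefixes_upto d N"
proof (intro set_eqI iffI)
  fix w
  assume "w \<in> suffixes_upto d N"
  then have "rev w \<in> prefixes_upto d N"
    by (auto simp: suffixes_upto_def prefixes_upto_def words_upto_iff last_rev)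
  then show "w \<in> rev ` prefixes_upto d N" using image_eqI[of w rev "rev w"] by simp
qed (auto simp: suffixes_upto_def prefixes_upto_def words_upto_iff hd_rev)

section \<open>Prefixes and suffixes as bases of words\<close>

lemma basis_of_words_prefixes: "basis_of_words d N (prefixes_upto d N)"
proof (rule basis_of_words_triangular[where t = "\<lambda>u. leading_zeros (rev u)"])
  fix u assume "u \<in> words d N"
  then obtain w where w: "w \<in> prefixes_upto d N" "u = w @ zeros (N - length w)"
    by (rule words_trailing_zerosE)
  then have last: "w = [] \<or> last w \<noteq> 0" by (simp add: prefixes_upto_def)
  then have "rev w = [] \<or> hd (rev w) \<noteq> 0" by (simp add: hd_rev)
  \<comment> \<open>The padding is the whole block of trailing zeros of \<open>u\<close>, so the
    grade of \<open>u\<close> is exactly the bound in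
    \<open>keys_shuffle_zeros_trailing\<close>.\<close>
  then have "leading_zeros (rev u) = N - length w"
    using leading_zeros_zeros_append w(2) by simp
  then show "\<exists>w\<in>prefixes_upto d N. Poly_Mapping.lookup (shuffle_fill N w) u \<noteq> 0 \<and>
      (\<forall>v\<in>Poly_Mapping.keys (shuffle_fill N w).
        v = u \<or> leading_zeros (rev v) < leading_zeros (rev u))"
    using w lookup_shuffle_zeros_append[of w "N - length w"] keys_shuffle_zeros_trailing[OF _ last]
    by (intro bexI[of _ w]) auto
next
  show "card (prefixes_upto d N) \<le> Suc d ^ N" by (simp add: card_prefixes_upto)
qed (auto simp: prefixes_upto_def)

text \<open>The word attached to \<open>u\<close> is found by decomposing \<open>rev u\<close> and
  reversing; the grading counts leading zeros instead of trailing ones.\<close>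

lemma basis_of_words_suffixes: "basis_of_words d N (suffixes_upto d N)"
proof (rule basis_of_words_triangular[where t = leading_zeros])
  fix u assume "u \<in> words d N"
  then have "rev u \<in> words d N" by (auto simp: words_def)
  then obtain w where w: "w \<in> prefixes_upto d N" "rev u = w @ zeros (N - length w)"
    by (rule words_trailing_zerosE)
  have rw: "rev w \<in> suffixes_upto d N" using w(1) by (simp add: suffixes_eq_rev_prefixes)
  then have hd: "rev w = [] \<or> hd (rev w) \<noteq> 0" by (simp add: suffixes_upto_def)
  have u: "u = zeros (N - length w) @ rev w"
    using arg_cong[OF w(2), of rev] by simp
  then have "leading_zeros u = N - length w"
    using leading_zeros_zeros_append[OF hd] by simp
  then show "\<exists>w\<in>suffixes_upto d N. Poly_Mapping.lookup (shuffle_fill N w) u \<noteq> 0 \<and>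
      (\<forall>v\<in>Poly_Mapping.keys (shuffle_fill N w). v = u \<or> leading_zeros v < leading_zeros u)"
    using rw u lookup_shuffle_zeros_prepend[of "rev w" "N - length w"]
      keys_shuffle_zeros_leading[OF _ hd]
    by (intro bexI[of _ "rev w"]) auto
next
  show "card (suffixes_upto d N) \<le> Suc d ^ N"
    by (simp add: suffixes_eq_rev_prefixes card_image card_prefixes_upto)
qed (auto simp: suffixes_upto_def)

subsection \<open>Minimality\<close>

text \<open>The words \<open>insert_zero n w\<close> for \<open>n \<le> length w\<close>, counted
  with multiplicity, are the terms of the shuffle of \<open>w\<close> with the letter
  \<open>0\<close>.\<close>

definition insert_zero :: "nat \<Rightarrow> word \<Rightarrow> word" where
  "insert_zero n w = take n w @ 0 # drop n w"

lemma insert_zero_snoc: "n \<le> length w \<Longrightarrow> insert_zero n (w @ [i]) = insert_zero n w @ [i]"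
  by (simp add: insert_zero_def)

lemma insert_zero_length: "insert_zero (length w) w = w @ [0]"
  by (simp add: insert_zero_def)

text \<open>
  The left-hand side is the shuffle of \<open>zeros m\<close> with the shuffle of \<open>w\<close> and the letter \<open>0\<close>; by
  associativity it is the shuffle of \<open>w\<close> with the shuffle of \<open>0\<close> and \<open>zeros m\<close>, the latter being
  \<open>m + 1\<close> times \<open>zeros (m + 1)\<close>.
\<close>

lemma sum_shuffle_insert_zero:
  "(\<Sum>n\<le>length w. shuffle (insert_zero n w) (zeros m)) = real (Suc m) *\<^sub>R shuffle w (zeros (Suc m))"
proof (induction "length w + m" arbitrary: w m rule: less_induct)
  case less
  show ?case
  proof (cases w rule: rev_cases)
    case Nil
    have "shuffle [0] (zeros m) = real (Suc m) *\<^sub>R of_word (zeros (Suc m))"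
    proof (induction m)
      case (Suc m)
      then show ?case
        using shuffle_zeros_snoc[of "[]" 0 m]
        by (simp add: shuffle_Nil conc_letter_linear_simps conc_of_word replicate_append_same
            scaleR_add_left scaleR_2)
    qed (simp add: shuffle_Nil)
    then show ?thesis using Nil by (simp add: insert_zero_def shuffle_Nil)
  next
    case (snoc v i)
    have IHv: "(\<Sum>n\<le>length v. shuffle (insert_zero n v) (zeros m)) =
        real (Suc m) *\<^sub>R shuffle v (zeros (Suc m))"
      using less snoc by simp
    \<comment> \<open>Insertion positions are split into those before the last letter
      \<open>i\<close> and the one after it.\<close>
    have sum_w: "(\<Sum>n\<le>length w. g (insert_zero n w)) =
        (\<Sum>n\<le>length v. g (insert_zero n v @ [i])) + g (w @ [0])" for g :: "word \<Rightarrow> word \<Rightarrow>\<^sub>0 real"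
      using snoc insert_zero_length[of w] by (simp add: insert_zero_snoc)
    show ?thesis
    proof (cases m)
      case 0
      have "(\<Sum>n\<le>length v. of_word (insert_zero n v @ [i])) =
          conc (\<Sum>n\<le>length v. of_word (insert_zero n v)) (of_word [i])"
        by (simp add: conc_letter_linear_simps conc_of_word)
      then show ?thesis
        using IHv sum_w[of of_word] shuffle_zeros_snoc[of v i 0] 0 snoc
        by (simp add: shuffle_Nil conc_of_word)
    next
      case (Suc k)
      have IHw: "(\<Sum>n\<le>length w. shuffle (insert_zero n w) (zeros k)) =
          real (Suc k) *\<^sub>R shuffle w (zeros (Suc k))"
        using less Suc by simp
      have "(\<Sum>n\<le>length w. shuffle (insert_zero n w) (zeros m)) =
          (\<Sum>n\<le>length v. conc (shuffle (insert_zero n v) (zeros m)) (of_word [i])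
            + conc (shuffle (insert_zero n v @ [i]) (zeros k)) (of_word [0]))
          + (conc (shuffle w (zeros m)) (of_word [0]) + conc (shuffle (w @ [0]) (zeros k)) (of_word [0]))"
        using sum_w[of "\<lambda>u. shuffle u (zeros m)"]
        by (simp add: Suc shuffle_zeros_snoc del: replicate_Suc)
      \<comment> \<open>The term for \<open>w @ [0]\<close> completes the second sum to all
        insertions into \<open>w\<close>, as needed for \<open>IHw\<close>.\<close>
      also have "\<dots> = conc (\<Sum>n\<le>length v. shuffle (insert_zero n v) (zeros m)) (of_word [i])
          + conc (\<Sum>n\<le>length w. shuffle (insert_zero n w) (zeros k)) (of_word [0])
          + conc (shuffle w (zeros m)) (of_word [0])"
        unfolding sum_w[of "\<lambda>u. shuffle u (zeros k)"]
        by (simp add: conc_letter_linear_simps sum.distrib)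
      \<comment> \<open>\<open>IHw\<close> yields \<open>Suc k = m\<close> copies of the term ending
        in the shuffled zero; the separate summand is the missing one.\<close>
      also have "\<dots> = real (Suc m) *\<^sub>R
          (conc (shuffle v (zeros (Suc m))) (of_word [i]) + conc (shuffle w (zeros m)) (of_word [0]))"
        unfolding IHv IHw using Suc
        by (simp only: conc_letter_linear_simps scaleR_add_right) (simp add: algebra_simps scaleR_2)
      also have "\<dots> = real (Suc m) *\<^sub>R shuffle w (zeros (Suc m))"
        unfolding snoc shuffle_zeros_snoc ..
      finally show ?thesis .
    qed
  qed
qed

text \<open>By \<open>sum_shuffle_insert_zero\<close>, a padded word is a multiple of a sum of
  padded words that are one letter longer. Repeating this raises the length to
  \<open>k\<close>.\<close>

lemma shuffle_fill_in_span_words: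
  assumes "length w \<le> k" "k \<le> N" "set w \<subseteq> {0..d}"
  shows "shuffle_fill N w \<in> span (shuffle_fill N ` words d k)"
  using assms
proof (induction "k - length w" arbitrary: w)
  case 0
  then have "w \<in> words d k" by (auto simp: words_def)
  then show ?case by (auto intro: span_base)
next
  case (Suc j)
  \<comment> \<open>One zero of the padding moves into the word. Here
    \<open>length w < k \<le> N\<close>, so the padding is nonempty.\<close>
  define m where "m = N - Suc (length w)"
  have m: "N - length w = Suc m" using Suc unfolding m_def by linarith
  have "shuffle (insert_zero n w) (zeros m) \<in> span (shuffle_fill N ` words d k)"
    if "n \<le> length w" for n
  proof -
    have len: "length (insert_zero n w) = Suc (length w)" using that by (simp add: insert_zero_def)
    moreover have "set (insert_zero n w) \<subseteq> {0..d}"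
      using Suc.prems(3) by (auto simp: insert_zero_def dest: in_set_takeD in_set_dropD)
    ultimately show ?thesis
      using Suc.hyps(1)[of "insert_zero n w"] Suc.hyps(2) Suc.prems by (simp add: m_def)
  qed
  then have "real (Suc m) *\<^sub>R shuffle w (zeros (Suc m)) \<in> span (shuffle_fill N ` words d k)"
    unfolding sum_shuffle_insert_zero[symmetric] by (intro span_sum) auto
  then have "(1 / real (Suc m)) *\<^sub>R real (Suc m) *\<^sub>R shuffle w (zeros (Suc m))
      \<in> span (shuffle_fill N ` words d k)"
    by (rule span_scale)
  then show ?case using m by simp
qed

text \<open>The short words of \<open>B\<close> yield independent vectors in a span of at most
  \<open>Suc d ^ k\<close> vectors, and injectivity turns this into a count of words.\<close>

lemma basis_of_words_card_short:
  assumes B: "basis_of_words d N B" and k: "k \<le> N"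
  shows "card {w \<in> B. length w \<le> k} \<le> Suc d ^ k"
proof -
  let ?f = "shuffle_fill N" and ?C = "{w \<in> B. length w \<le> k}"
  have sub: "B \<subseteq> words_upto d N" and inj: "inj_on ?f B" and ind: "independent (?f ` B)"
    using B by (simp_all add: basis_of_words_def Let_def)
  have "?f ` ?C \<subseteq> span (?f ` words d k)"
    using sub k shuffle_fill_in_span_words by (fastforce simp: words_upto_iff)
  then have "card (?f ` ?C) \<le> card (?f ` words d k)"
    using independent_span_bound[of "?f ` words d k" "?f ` ?C"]
      independent_mono[OF ind, of "?f ` ?C"] finite_words by blast
  also have "\<dots> \<le> Suc d ^ k"
    using card_image_le[OF finite_words, of ?f d k] by (simp add: card_words)
  finally show ?thesis
    using card_image[OF inj_on_subset[OF inj, of ?C]] by auto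
qed

text \<open>The upper bound is the count of short words at \<open>k = N\<close>. For the lower
  bound, the family spans the independent words of length \<open>N\<close>.\<close>

lemma basis_of_words_card:
  assumes "basis_of_words d N B"
  shows "card B = Suc d ^ N"
proof (rule antisym)
  let ?f = "shuffle_fill N"
  have sub: "B \<subseteq> words_upto d N" and sp: "span (?f ` B) = Span (words d N)"
    using assms by (simp_all add: basis_of_words_def Let_def)
  have "{w \<in> B. length w \<le> N} = B" using sub by (auto simp: words_upto_iff)
  then show "card B \<le> Suc d ^ N" using basis_of_words_card_short[OF assms, of N] by simp
  have fin: "finite B" using sub finite_words_upto finite_subset by blast
  have "of_word ` words d N \<subseteq> span (?f ` B)"
    unfolding sp Span_def by (rule span_superset)
  then have "card (of_word ` words d N) \<le> card (?f ` B)"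
    using independent_span_bound[OF _ independent_of_word] fin by blast
  also have "\<dots> \<le> card B" by (rule card_image_le[OF fin])
  finally show "Suc d ^ N \<le> card B"
    by (simp add: card_words card_image[OF inj_on_subset[OF inj_of_word]])
qed

text \<open>Layer-cake summation: write \<open>g x\<close> as the number of \<open>k < g x\<close>
  and swap the sums. Complements of sublevel sets appear so that upper bounds on short words become
  lower bounds on total length.\<close>

lemma sum_eq_sum_card_superlevel:
  fixes g :: "'a \<Rightarrow> nat"
  assumes "finite B" "\<And>x. x \<in> B \<Longrightarrow> g x \<le> N"
  shows "(\<Sum>x\<in>B. g x) = (\<Sum>k<N. card B - card {x \<in> B. g x \<le> k})"
proof -
  have "(\<Sum>x\<in>B. g x) = (\<Sum>x\<in>B. \<Sum>k<N. if k < g x then 1 else 0)"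
  proof (rule sum.cong)
    fix x assume "x \<in> B"
    then have "{k \<in> {..<N}. k < g x} = {..<g x}" using assms(2)[of x] by auto
    then show "g x = (\<Sum>k<N. if k < g x then 1 else 0)"
      by (simp flip: sum.inter_filter)
  qed simp
  also have "\<dots> = (\<Sum>k<N. card {x \<in> B. k < g x})"
    by (subst sum.swap) (simp add: assms(1) flip: sum.inter_filter)
  also have "\<dots> = (\<Sum>k<N. card B - card {x \<in> B. g x \<le> k})"
  proof (rule sum.cong)
    fix k
    have "{x \<in> B. k < g x} = B - {x \<in> B. g x \<le> k}" by auto
    then show "card {x \<in> B. k < g x} = card B - card {x \<in> B. g x \<le> k}"
      using assms(1) by (simp add: card_Diff_subset)
  qed simp
  finally show ?thesis .
qed

lemma word_length_sum_prefixes_le: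
  assumes "basis_of_words d N B"
  shows "word_length_sum (prefixes_upto d N) \<le> word_length_sum B"
proof -
  have sub: "B \<subseteq> words_upto d N" using assms by (simp add: basis_of_words_def)
  have P: "prefixes_upto d N \<subseteq> words_upto d N" by (auto simp: prefixes_upto_def)
  have superlevel: "(\<Sum>w\<in>C. length w) = (\<Sum>k<N. card C - card {w \<in> C. length w \<le> k})"
    if C: "C \<subseteq> words_upto d N" for C
    using finite_subset[OF C finite_words_upto] subsetD[OF C]
    by (intro sum_eq_sum_card_superlevel) (auto simp: words_upto_iff)
  \<comment> \<open>The prefixes thus have \<open>Suc d ^ k\<close> words of length at most
    \<open>k\<close>, attaining the bound for bases at every level simultaneously.\<close>
  have short: "{w \<in> prefixes_upto d N. length w \<le> k} = prefixes_upto d k" if "k < N" for k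
    using that by (auto simp: prefixes_upto_def words_upto_iff)
  have "word_length_sum (prefixes_upto d N) = (\<Sum>k<N. Suc d ^ N - Suc d ^ k)"
    unfolding word_length_sum_def
    by (subst superlevel[OF P]) (simp add: short card_prefixes_upto)
  also have "\<dots> \<le> (\<Sum>k<N. card B - card {w \<in> B. length w \<le> k})"
    using basis_of_words_card_short[OF assms]
    by (auto simp: basis_of_words_card[OF assms] intro!: sum_mono diff_le_mono2)
  also have "\<dots> = word_length_sum B"
    unfolding word_length_sum_def superlevel[OF sub] ..
  finally show ?thesis .
qed

lemma word_length_sum_suffixes:
  "word_length_sum (suffixes_upto d N) = word_length_sum (prefixes_upto d N)"
  by (simp add: word_length_sum_def suffixes_eq_rev_prefixes sum.reindex)

section \<open>Closures and comparison of costs\<close>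

lemma all_words_iff: "w \<in> all_words d \<longleftrightarrow> set w \<subseteq> {0..d}"
  by (auto simp: all_words_def words_def)

lemma closure_subset_words_upto:
  assumes "B \<subseteq> words_upto d N"
  shows "backward_closure d B \<subseteq> words_upto d N" "forward_closure d B \<subseteq> words_upto d N"
  using assms
  by (fastforce simp: backward_closure_def forward_closure_def all_words_iff words_upto_iff)+

lemma subset_closure:
  assumes "B \<subseteq> words_upto d N"
  shows "B \<subseteq> backward_closure d B" "B \<subseteq> forward_closure d B"
  using assms
  by (fastforce simp: backward_closure_def forward_closure_def all_words_iff words_upto_iff
      intro: bexI[of _ "[]"])+

text \<open>A nonempty tail of a word has the same last letter.\<close>

lemma backward_closure_prefixes: "backward_closure d (prefixes_upto d N) = prefixes_upto d N"
proof
  show "prefixes_upto d N \<subseteq> backward_closure d (prefixes_upto d N)"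
    by (rule subset_closure[where N = N]) (auto simp: prefixes_upto_def)
qed (auto simp: backward_closure_def prefixes_upto_def words_upto_iff last_append split: if_splits)

text \<open>A nonempty initial segment keeps the first letter.\<close>

lemma forward_closure_suffixes: "forward_closure d (suffixes_upto d N) = suffixes_upto d N"
proof
  show "suffixes_upto d N \<subseteq> forward_closure d (suffixes_upto d N)"
    by (rule subset_closure[where N = N]) (auto simp: suffixes_upto_def)
qed (auto simp: forward_closure_def suffixes_upto_def words_upto_iff hd_append split: if_splits)

lemma word_length_sum_mono: "finite B \<Longrightarrow> A \<subseteq> B \<Longrightarrow> word_length_sum A \<le> word_length_sum B"
  by (simp add: word_length_sum_def sum_mono2)

lemma backward_cost_prefixes_le:
  assumes B: "basis_of_words d N B"
  shows "backward_cost d (prefixes_upto d N) K \<le> backward_cost d B K"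
proof -
  have sub: "B \<subseteq> words_upto d N" using B by (simp add: basis_of_words_def)
  have fin: "finite (backward_closure d B)"
    using finite_subset[OF closure_subset_words_upto(1)[OF sub] finite_words_upto] .
  note L = word_length_sum_prefixes_le[OF B]
  have "card (prefixes_upto d N) \<le> card (backward_closure d B)"
    using card_mono[OF fin subset_closure(1)[OF sub]] basis_of_words_card[OF B] card_prefixes_upto
    by simp
  moreover have "word_length_sum (prefixes_upto d N) \<le> word_length_sum (backward_closure d B)"
    using L word_length_sum_mono[OF fin subset_closure(1)[OF sub]] by simp
  ultimately show ?thesis
    unfolding backward_cost_def backward_closure_prefixes using L
    by (intro add_mono mult_le_mono2)
qed

lemma forward_cost_suffixes_le:
  assumes B: "basis_of_words d N B"
  shows "forward_cost d (suffixes_upto d N) K \<le> forward_cost d B K"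
proof -
  have sub: "B \<subseteq> words_upto d N" using B by (simp add: basis_of_words_def)
  have fin: "finite (forward_closure d B)"
    using finite_subset[OF closure_subset_words_upto(2)[OF sub] finite_words_upto] .
  \<comment> \<open>Reversal preserves lengths, so the bound for the prefixes carries over.\<close>
  have L: "word_length_sum (suffixes_upto d N) \<le> word_length_sum B"
    using word_length_sum_prefixes_le[OF B] word_length_sum_suffixes by simp
  have "card (suffixes_upto d N) \<le> card (forward_closure d B)"
    using card_mono[OF fin subset_closure(2)[OF sub]]
      basis_of_words_card[OF B] basis_of_words_card[OF basis_of_words_suffixes] by simp
  moreover have "word_length_sum (suffixes_upto d N) \<le> word_length_sum (forward_closure d B)"
    using L word_length_sum_mono[OF fin subset_closure(2)[OF sub]] by simp
  ultimately show ?thesis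
    unfolding forward_cost_def forward_closure_suffixes using L
    by (intro add_mono mult_le_mono2)
qed

theorem theorem6:
  fixes d N :: nat
  assumes "d \<ge> 1"
  shows "basis_of_words d N (prefixes_upto d N)
    \<and> basis_of_words d N (suffixes_upto d N)
    \<and> (\<forall>K B. K \<ge> 2 \<longrightarrow> basis_of_words d N B \<longrightarrow>
          backward_cost d (prefixes_upto d N) K \<le> backward_cost d B K
        \<and> forward_cost d (suffixes_upto d N) K \<le> forward_cost d B K)"
  using basis_of_words_prefixes basis_of_words_suffixes
    backward_cost_prefixes_le forward_cost_suffixes_le by blast

end
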